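(* Every negative formula is concise in the class of compact Hausdorff groups; that is, if $\varphi$ is a negative formula and $G$ is a compact Hausdorff topological group such that $G_\varphi$ is finite, then the closure of the subgroup $\langle G_\varphi\rangle$ is finite.
   Context: A formula means a first-order formula with exactly one free variable $y$ in the language of groups, without parameters. For a formula $\varphi$ and a group $G$, put $G_\varphi=\{g\in G\mid \varphi(g)\text{ is true in }G\}$. A formula is negative if it is logically equivalent to one of the shape $Q\,\underline{x}\colon p(w_1(\underline x,y)\neq 1,\dots,w_n(\underline x,y)\neq 1)$, where $Q$ is any string of quantifiers (each $\forall$ or $\exists$) binding the variables $\underline x$, each $w_i$ is a group word, and $p$ is a positive boolean combination (using only $\land$ and $\lor$, without negation). A formula $\varphi$ is concise in a class $\mathcal T$ of topological groups if for every $G\in\mathcal T$ with $G_\varphi$ finite, the closure of the subgroup $\langle G_\varphi\rangle$ is finite. *)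

theory Defs
  imports "HOL-Algebra.Generated_Groups" "HOL-Analysis.Analysis"
begin

section \<open>First-order formulas in the language of groups\<close>

text \<open>Group words are rendered as terms of the language of groups; there are no parameters.\<close>

datatype gterm = TVar nat | TOne | TInv gterm | TMult gterm gterm

datatype gform =
    Eq gterm gterm
  | Neg gform
  | Conj gform gform
  | Disj gform gform
  | All nat gform
  | Ex nat gform

primrec tvars :: "gterm \<Rightarrow> nat set" where
  "tvars (TVar x) = {x}"
| "tvars TOne = {}"
| "tvars (TInv t) = tvars t"
| "tvars (TMult s t) = tvars s \<union> tvars t"

primrec free_vars :: "gform \<Rightarrow> nat set" where
  "free_vars (Eq s t) = tvars s \<union> tvars t"
| "free_vars (Neg \<phi>) = free_vars \<phi>"
| "free_vars (Conj \<phi> \<psi>) = free_vars \<phi> \<union> free_vars \<psi>"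
| "free_vars (Disj \<phi> \<psi>) = free_vars \<phi> \<union> free_vars \<psi>"
| "free_vars (All x \<phi>) = free_vars \<phi> - {x}"
| "free_vars (Ex x \<phi>) = free_vars \<phi> - {x}"

primrec tval :: "'a monoid \<Rightarrow> (nat \<Rightarrow> 'a) \<Rightarrow> gterm \<Rightarrow> 'a" where
  "tval G e (TVar x) = e x"
| "tval G e TOne = \<one>\<^bsub>G\<^esub>"
| "tval G e (TInv t) = inv\<^bsub>G\<^esub> (tval G e t)"
| "tval G e (TMult s t) = tval G e s \<otimes>\<^bsub>G\<^esub> tval G e t"

primrec sat :: "'a monoid \<Rightarrow> (nat \<Rightarrow> 'a) \<Rightarrow> gform \<Rightarrow> bool" where
  "sat G e (Eq s t) \<longleftrightarrow> tval G e s = tval G e t"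
| "sat G e (Neg \<phi>) \<longleftrightarrow> \<not> sat G e \<phi>"
| "sat G e (Conj \<phi> \<psi>) \<longleftrightarrow> sat G e \<phi> \<and> sat G e \<psi>"
| "sat G e (Disj \<phi> \<psi>) \<longleftrightarrow> sat G e \<phi> \<or> sat G e \<psi>"
| "sat G e (All x \<phi>) \<longleftrightarrow> (\<forall>g\<in>carrier G. sat G (e(x := g)) \<phi>)"
| "sat G e (Ex x \<phi>) \<longleftrightarrow> (\<exists>g\<in>carrier G. sat G (e(x := g)) \<phi>)"

text \<open>
  For a formula whose only free variable is \<open>y\<close>, the values assigned to the other
  variables are irrelevant; they are set to the identity.
\<close>

definition truth_set :: "'a monoid \<Rightarrow> nat \<Rightarrow> gform \<Rightarrow> 'a set" where
  "truth_set G y \<phi> = {g \<in> carrier G. sat G ((\<lambda>_. \<one>\<^bsub>G\<^esub>)(y := g)) \<phi>}"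

text \<open>
  Logical equivalence means equivalence in all groups. HOL cannot quantify over types inside a
  formula, so the definition ranges over all groups (of any order) whose elements lie in a given
  type \<open>'a\<close>. Formulas that are equivalent in all groups are equivalent in this sense for every
  \<open>'a\<close>; by the Loewenheim-Skolem theorem the converse holds already for one infinite \<open>'a\<close>.
\<close>

definition logically_equivalent :: "'a itself \<Rightarrow> gform \<Rightarrow> gform \<Rightarrow> bool" where
  "logically_equivalent _ \<phi> \<psi> \<longleftrightarrow>
     (\<forall>G :: 'a monoid. group G \<longrightarrow>
        (\<forall>e. range e \<subseteq> carrier G \<longrightarrow> (sat G e \<phi> \<longleftrightarrow> sat G e \<psi>)))"


section \<open>Negative formulas\<close>

inductive positive_combination_of_inequations :: "gform \<Rightarrow> bool" where
  "positive_combination_of_inequations (Neg (Eq w TOne))"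
| "positive_combination_of_inequations \<phi> \<Longrightarrow> positive_combination_of_inequations \<psi> \<Longrightarrow>
     positive_combination_of_inequations (Conj \<phi> \<psi>)"
| "positive_combination_of_inequations \<phi> \<Longrightarrow> positive_combination_of_inequations \<psi> \<Longrightarrow>
     positive_combination_of_inequations (Disj \<phi> \<psi>)"

text \<open>
  Prenex shape, the bound variables being different from \<open>y\<close>. That no variable other than \<open>y\<close>
  remains free is required separately below; \<open>y\<close> itself need not occur in the words.
\<close>

inductive negative_shape :: "nat \<Rightarrow> gform \<Rightarrow> bool" for y where
  "positive_combination_of_inequations \<phi> \<Longrightarrow> negative_shape y \<phi>"
| "negative_shape y \<phi> \<Longrightarrow> x \<noteq> y \<Longrightarrow> negative_shape y (All x \<phi>)"
| "negative_shape y \<phi> \<Longrightarrow> x \<noteq> y \<Longrightarrow> negative_shape y (Ex x \<phi>)"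

definition negative_formula :: "'a itself \<Rightarrow> nat \<Rightarrow> gform \<Rightarrow> bool" where
  "negative_formula T y \<phi> \<longleftrightarrow>
     free_vars \<phi> = {y} \<and>
     (\<exists>\<psi>. negative_shape y \<psi> \<and> free_vars \<psi> \<subseteq> {y} \<and> logically_equivalent T \<phi> \<psi>)"


section \<open>Topological groups and conciseness\<close>

definition topological_group :: "'a monoid \<Rightarrow> 'a topology \<Rightarrow> bool" where
  "topological_group G T \<longleftrightarrow>
     group G \<and> topspace T = carrier G \<and>
     continuous_map (prod_topology T T) T (\<lambda>(g, h). g \<otimes>\<^bsub>G\<^esub> h) \<and>
     continuous_map T T (\<lambda>g. inv\<^bsub>G\<^esub> g)"

definition compact_Hausdorff_groups :: "('a monoid \<times> 'a topology) set" where
  "compact_Hausdorff_groups =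
     {(G, T). topological_group G T \<and> compact_space T \<and> Hausdorff_space T}"

definition concise_in :: "('a monoid \<times> 'a topology) set \<Rightarrow> nat \<Rightarrow> gform \<Rightarrow> bool" where
  "concise_in \<T> y \<phi> \<longleftrightarrow>
     (\<forall>(G, T)\<in>\<T>. finite (truth_set G y \<phi>) \<longrightarrow>
        finite (T closure_of (generate G (truth_set G y \<phi>))))"

end

theory Submission
  imports Defs
begin

text \<open>
  In a compact Hausdorff group the truth set of a negative formula is open: inequations define open
  sets, projections of open sets are open, and universal quantification over a compact space
  preserves openness because projection along a compact factor is a closed map. A nonempty finite
  open set makes a Hausdorff group discrete, and a compact discrete group is finite.
\<close>

text \<open>This makes substitution of a value for one variable continuous. It serves with value and
  environment both varying (universal quantifier), with the value fixed (existential quantifier),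
  and with the environment constant (truth set).\<close>

lemma continuous_map_fun_upd:
  assumes "continuous_map X (product_topology (\<lambda>_. T) UNIV) f" "continuous_map X T h"
  shows "continuous_map X (product_topology (\<lambda>_. T) UNIV) (\<lambda>p. (f p)(x := h p))"
proof -
  have "continuous_map X T (\<lambda>p. ((f p)(x := h p)) k)" for k
    using assms by (cases "k = x") (auto simp: continuous_map_componentwise_UNIV)
  then show ?thesis
    by (simp only: continuous_map_componentwise_UNIV) blast
qed

lemma continuous_map_tval:
  assumes "topological_group G T"
  shows "continuous_map (product_topology (\<lambda>_. T) UNIV) T (\<lambda>e. tval G e t)"
proof (induction t)
  case (TVar x)
  show ?case
    using continuous_map_product_projection[of x UNIV "\<lambda>_. T"] by simp
next
  case TOne
  then show ?case
    using assms by (auto simp: topological_group_def group.is_monoid)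
next
  case (TInv t)
  have "continuous_map T T (\<lambda>g. inv\<^bsub>G\<^esub> g)"
    using assms by (simp add: topological_group_def)
  then show ?case
    using continuous_map_compose[OF TInv] by (simp add: o_def)
next
  case (TMult s t)
  have "continuous_map (prod_topology T T) T (\<lambda>(g, h). g \<otimes>\<^bsub>G\<^esub> h)"
    using assms by (simp add: topological_group_def)
  from continuous_map_compose[OF continuous_map_pairedI[OF TMult] this] show ?case
    by (simp add: o_def)
qed

text \<open>The T1 axiom makes the identity a closed point, so each inequation is an open condition
  by continuity of words. Without further negations only finite unions and intersections
  occur.\<close>

lemma openin_sat_positive_combination:
  assumes "topological_group G T" "t1_space T"
    and "positive_combination_of_inequations \<psi>"
  shows "openin (product_topology (\<lambda>_. T) UNIV)
           {e \<in> topspace (product_topology (\<lambda>_. T) UNIV). sat G e \<psi>}"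
  using assms(3)
proof (induction rule: positive_combination_of_inequations.induct)
  case (1 w)
  let ?P = "product_topology (\<lambda>_. T) (UNIV :: nat set)"
  have "\<one>\<^bsub>G\<^esub> \<in> topspace T"
    using assms(1) by (auto simp: topological_group_def group.is_monoid)
  then have "openin T (topspace T - {\<one>\<^bsub>G\<^esub>})"
    using assms(2) by (simp add: closedin_t1_singleton openin_diff)
  then have "openin ?P {e \<in> topspace ?P. tval G e w \<in> topspace T - {\<one>\<^bsub>G\<^esub>}}"
    using continuous_map_tval[OF assms(1)] openin_continuous_map_preimage by blast
  \<comment> \<open>Words take values in \<open>topspace T\<close>, so only the condition of
    differing from the identity remains.\<close>
  moreover have "{e \<in> topspace ?P. tval G e w \<in> topspace T - {\<one>\<^bsub>G\<^esub>}}
      = {e \<in> topspace ?P. sat G e (Neg (Eq w TOne))}"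
    using continuous_map_tval[OF assms(1), of w] by (auto simp: continuous_map_def)
  ultimately show ?case by simp
next
  case (2 \<phi> \<psi>)
  then show ?case
    using openin_Int[OF "2.IH"] by (simp add: Collect_conj_eq Int_ac)
next
  case (3 \<phi> \<psi>)
  show ?case
    using openin_Un[OF "3.IH"] by (simp add: Collect_conj_eq Collect_disj_eq Int_Un_distrib)
qed

text \<open>Openness is stated in the space of all environments, not in \<open>y\<close> alone, so
  that the induction can pass under quantifiers, where further variables are free.\<close>

lemma openin_sat_negative_shape:
  assumes "topological_group G T" "t1_space T" "compact_space T" and "negative_shape y \<psi>"
  shows "openin (product_topology (\<lambda>_. T) UNIV)
           {e \<in> topspace (product_topology (\<lambda>_. T) UNIV). sat G e \<psi>}"
  using assms(4)
proof (induction rule: negative_shape.induct)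
  case (1 \<phi>)
  then show ?case
    using openin_sat_positive_combination assms by blast
next
  case (2 \<phi> x)
  let ?P = "product_topology (\<lambda>_. T) (UNIV :: nat set)"
  let ?X = "prod_topology T ?P"
  let ?S = "{e \<in> topspace ?P. sat G e \<phi>}"
  \<comment> \<open>Pairs of a value for \<open>x\<close> and an environment that together falsify
    the body. The projection to the environment is the set where \<open>All x \<phi>\<close>
    fails.\<close>
  let ?C = "{p \<in> topspace ?X. (snd p)(x := fst p) \<in> topspace ?P - ?S}"
  have T: "topspace T = carrier G"
    using assms(1) by (simp add: topological_group_def)
  have "continuous_map ?X ?P (\<lambda>p. (snd p)(x := fst p))"
    by (intro continuous_map_fun_upd continuous_map_snd continuous_map_fst)
  then have "closedin ?X ?C"
    using closedin_continuous_map_preimage[OF _ closedin_diff[OF closedin_topspace "2.IH"]] by blast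
  \<comment> \<open>Compactness of \<open>T\<close> enters here: projection along a compact factor
    is closed.\<close>
  then have "closedin ?P (snd ` ?C)"
    using closed_map_snd[OF assms(3), of ?P] by (simp add: closed_map_def)
  then have "openin ?P (topspace ?P - snd ` ?C)"
    by (rule openin_diff[OF openin_topspace])
  moreover have "e \<in> snd ` ?C \<longleftrightarrow> (\<exists>g\<in>carrier G. \<not> sat G (e(x := g)) \<phi>)"
    if e: "e \<in> topspace ?P" for e
  proof
    assume "e \<in> snd ` ?C"
    then show "\<exists>g\<in>carrier G. \<not> sat G (e(x := g)) \<phi>"
      by (auto simp: T)
  next
    assume "\<exists>g\<in>carrier G. \<not> sat G (e(x := g)) \<phi>"
    then obtain g where g: "g \<in> carrier G" "\<not> sat G (e(x := g)) \<phi>"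
      by blast
    moreover have "e(x := g) \<in> topspace ?P"
      using e g(1) by (auto simp: T PiE_iff)
    ultimately have "(g, e) \<in> ?C"
      using e by (simp add: T)
    then have "snd (g, e) \<in> snd ` ?C"
      by (rule imageI)
    then show "e \<in> snd ` ?C"
      by (simp only: snd_conv)
  qed
  then have "topspace ?P - snd ` ?C = {e \<in> topspace ?P. sat G e (All x \<phi>)}"
    by (auto simp: T)
  ultimately show ?case by simp
next
  case (3 \<phi> x)
  let ?P = "product_topology (\<lambda>_. T) (UNIV :: nat set)"
  let ?S = "{e \<in> topspace ?P. sat G e \<phi>}"
  have T: "topspace T = carrier G"
    using assms(1) by (simp add: topological_group_def)
  \<comment> \<open>For each fixed witness \<open>g\<close> the condition is a preimage of an open
    set under substitution; the existential quantifier is the union over all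
    \<open>g\<close>.\<close>
  have "openin ?P {e \<in> topspace ?P. e(x := g) \<in> ?S}" if "g \<in> carrier G" for g
  proof -
    have "continuous_map ?P ?P (\<lambda>e. e(x := g))"
      using that T by (intro continuous_map_fun_upd) auto
    then show ?thesis
      using openin_continuous_map_preimage "3.IH" by blast
  qed
  then have "openin ?P (\<Union>g\<in>carrier G. {e \<in> topspace ?P. e(x := g) \<in> ?S})"
    by blast
  moreover have "(\<Union>g\<in>carrier G. {e \<in> topspace ?P. e(x := g) \<in> ?S})
      = {e \<in> topspace ?P. sat G e (Ex x \<phi>)}"
    by (auto simp: T PiE_iff)
  ultimately show ?case by simp
qed

lemma openin_truth_set:
  fixes G :: "'a monoid"
  assumes "topological_group G T" "t1_space T" "compact_space T"
    and "negative_formula TYPE('a) y \<phi>"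
  shows "openin T (truth_set G y \<phi>)"
proof -
  let ?P = "product_topology (\<lambda>_. T) (UNIV :: nat set)"
  let ?e = "\<lambda>g. (\<lambda>_. \<one>\<^bsub>G\<^esub>)(y := g)"
  interpret group G
    using assms(1) by (simp add: topological_group_def)
  have T: "topspace T = carrier G"
    using assms(1) by (simp add: topological_group_def)
  obtain \<psi> where \<psi>: "negative_shape y \<psi>" "logically_equivalent TYPE('a) \<phi> \<psi>"
    using assms(4) by (auto simp: negative_formula_def)
  have env: "?e g \<in> topspace ?P" if "g \<in> carrier G" for g
    using that by (auto simp: T PiE_iff)
  have "sat G (?e g) \<phi> \<longleftrightarrow> sat G (?e g) \<psi>" if "g \<in> carrier G" for g
  proof -
    \<comment> \<open>Logical equivalence speaks only about environments with values in the
      group.\<close>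
    have "range (?e g) \<subseteq> carrier G"
      using that by auto
    then show ?thesis
      using \<psi>(2) group_axioms by (simp add: logically_equivalent_def)
  qed
  then have "truth_set G y \<phi> = {g \<in> topspace T. ?e g \<in> {e \<in> topspace ?P. sat G e \<psi>}}"
    using env by (auto simp: truth_set_def T)
  \<comment> \<open>Coordinate \<open>y\<close> is the identity map and all others are constant, so
    the truth set is a continuous preimage of an open set.\<close>
  moreover have "continuous_map T ?P ?e"
    using T by (intro continuous_map_fun_upd) (auto simp: continuous_map_componentwise_UNIV)
  ultimately show ?thesis
    using openin_continuous_map_preimage openin_sat_negative_shape[OF assms(1-3) \<psi>(1)] by fastforce
qed

text \<open>Left translations carry one isolated point to every other, so the topology is discrete,
  and a compact discrete space is finite.\<close>

lemma compact_group_open_singleton_imp_finite: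
  assumes "topological_group G T" "compact_space T" "openin T {g}"
  shows "finite (carrier G)"
proof -
  interpret group G
    using assms(1) by (simp add: topological_group_def)
  have T: "topspace T = carrier G"
    using assms(1) by (simp add: topological_group_def)
  have g: "g \<in> carrier G"
    using openin_subset[OF assms(3)] T by simp
  have mult: "continuous_map (prod_topology T T) T (\<lambda>(a, b). a \<otimes>\<^bsub>G\<^esub> b)"
    using assms(1) by (simp add: topological_group_def)
  have "openin T {h}" if h: "h \<in> carrier G" for h
  proof -
    \<comment> \<open>Chosen so that left translation by \<open>c\<close> sends \<open>h\<close> to
      \<open>g\<close>; by cancellation the preimage of \<open>{g}\<close> is then exactly
      \<open>{h}\<close>.\<close>
    define c where "c = g \<otimes>\<^bsub>G\<^esub> inv\<^bsub>G\<^esub> h"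
    have c: "c \<in> carrier G"
      using g h by (simp add: c_def)
    have "continuous_map T (prod_topology T T) (\<lambda>x. (c, x))"
      using c T by (intro continuous_map_pairedI) auto
    from continuous_map_compose[OF this mult] have "continuous_map T T (\<lambda>x. c \<otimes>\<^bsub>G\<^esub> x)"
      by (simp add: o_def)
    then have "openin T {x \<in> topspace T. c \<otimes>\<^bsub>G\<^esub> x \<in> {g}}"
      using assms(3) openin_continuous_map_preimage by blast
    moreover have ch: "c \<otimes>\<^bsub>G\<^esub> h = g"
      using g h by (simp add: c_def m_assoc)
    have "{x \<in> topspace T. c \<otimes>\<^bsub>G\<^esub> x \<in> {g}} = {h}"
      using h c by (auto simp: T simp flip: ch)
    ultimately show ?thesis by simp
  qed
  then have "T = discrete_topology (carrier G)"
    using T by (metis discrete_topology_unique)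
  then show ?thesis
    using assms(2) compact_space_discrete_topology by metis
qed

theorem theorem1p5:
  fixes \<phi> :: gform and y :: nat
  assumes "negative_formula TYPE('a) y \<phi>"
  shows "concise_in (compact_Hausdorff_groups :: ('a monoid \<times> 'a topology) set) y \<phi>"
  unfolding concise_in_def
proof clarify
  fix G :: "'a monoid" and T :: "'a topology"
  assume "(G, T) \<in> compact_Hausdorff_groups" and fin: "finite (truth_set G y \<phi>)"
  then have G: "topological_group G T" and comp: "compact_space T" and haus: "Hausdorff_space T"
    by (auto simp: compact_Hausdorff_groups_def)
  interpret group G
    using G by (simp add: topological_group_def)
  have T: "topspace T = carrier G"
    using G by (simp add: topological_group_def)
  have t1: "t1_space T"
    using haus by (rule Hausdorff_imp_t1_space)
  show "finite (T closure_of generate G (truth_set G y \<phi>))"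
  proof (cases "truth_set G y \<phi> = {}")
    case True
    \<comment> \<open>The empty set generates the trivial subgroup, which is its own
      closure.\<close>
    have "closedin T {\<one>\<^bsub>G\<^esub>}"
      using t1 T by (simp add: closedin_t1_singleton)
    then show ?thesis
      using True by (simp add: generate_empty closure_of_closedin)
  next
    case False
    then obtain g where g: "g \<in> truth_set G y \<phi>" by blast
    \<comment> \<open>Removing the finitely many other points, a closed set in a T1 space, from the
      open truth set isolates \<open>g\<close>.\<close>
    then have "truth_set G y \<phi> - (truth_set G y \<phi> - {g}) = {g}" by blast
    moreover have "closedin T (truth_set G y \<phi> - {g})"
      using t1 fin T by (auto simp: t1_space_closedin_finite truth_set_def)
    ultimately have "openin T {g}"
      using openin_diff[OF openin_truth_set[OF G t1 comp assms]] by metis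
    then have "finite (carrier G)"
      using compact_group_open_singleton_imp_finite[OF G comp] by blast
    then show ?thesis
      using closure_of_subset_topspace T by (metis finite_subset)
  qed
qed

end
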